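(* Let $\alpha\in(0,1]$ and $\beta\in[0,\alpha)$. There exists a convex function $f\in\mathcal{L}_{\mathrm{sym}}^*(\alpha)$ with a unique minimizer such that for any learning rate $\gamma>0$ there is a constant $C>0$ such that the $\beta$-GD algorithm with learning rate $\gamma$ diverges for every initialization $w_0$ with $\|w_0\|>C$.
   Context: For $\alpha\in[0,1]$, $\mathcal{L}_{\mathrm{sym}}^*(\alpha)$ is the class of differentiable $f:\mathbb{R}^d\to\mathbb{R}$ for which there are constants $L_0,L_1>0$ with $$\|\nabla f(w')-\nabla f(w)\|\le\Big(L_0+L_1\max_{\theta\in[0,1]}\|\nabla f(\theta w'+(1-\theta)w)\|^{\alpha}\Big)\|w'-w\|\quad\text{for all } w,w'\in\mathbb{R}^d.$$ $\beta$-GD: given $w_0$, $\gamma$, $\beta$, iterate $w_{t+1}=w_t-\gamma\frac{\nabla f(w_t)}{\|\nabla f(w_t)\|^{\beta}}$ for $t=0,1,2,\dots$ (with $w_{t+1}=w_t$ if $\nabla f(w_t)=0$). "Diverges" means that $\|w_t\|\to\infty$ as $t\to\infty$. The dimension $d$ may be chosen along with $f$ (e.g. $d=1$). Convention: $0^0=1$. *)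

theory Defs
  imports "HOL-Analysis.Analysis"
begin

definition grad :: "('a::euclidean_space \<Rightarrow> real) \<Rightarrow> 'a \<Rightarrow> 'a" where
  "grad f w = (THE D. GDERIV f w :> D)"

lemma grad_eqI:
  assumes "GDERIV f w :> D"
  shows "grad f w = D"
proof -
  have "D' = D" if "GDERIV f w :> D'" for D'
  proof -
    have "(\<lambda>h. inner h D') = (\<lambda>h. inner h D)"
      using that assms has_derivative_unique unfolding gderiv_def by blast
    then have "inner h D' = inner h D" for h
      by meson
    then show ?thesis
      by (metis inner_commute vector_eq_rdot)
  qed
  then show ?thesis
    unfolding grad_def using assms by blast
qed

lemma GDERIV_grad:
  assumes "f differentiable (at w)"
  shows "GDERIV f w :> grad f w"
proof -
  obtain F where F: "(f has_derivative F) (at w)"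
    using assms unfolding differentiable_def by blast
  then have "linear F"
    by (rule has_derivative_linear)
  then have "F = (\<lambda>h. inner h (adjoint F 1))"
    using adjoint_works[of F _ 1] by fastforce
  with F have "GDERIV f w :> adjoint F 1"
    unfolding gderiv_def by metis
  then show ?thesis
    using grad_eqI by metis
qed

text \<open>
  Real powers of nonnegative reals with the convention that zero to the power zero is one;
  the library has \<open>0 powr 0 = 0\<close>.
\<close>
definition rpow :: "real \<Rightarrow> real \<Rightarrow> real" where
  "rpow x a = (if a = 0 then 1 else x powr a)"

text \<open>
  A supremum over the segment would have an arbitrary value in case of an unbounded gradient, so
  the maximum is required to be attained.
\<close>
definition is_maximum :: "real \<Rightarrow> real set \<Rightarrow> bool" where
  "is_maximum M S \<longleftrightarrow> M \<in> S \<and> (\<forall>x\<in>S. x \<le> M)"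

definition L_sym_star :: "real \<Rightarrow> ('a::euclidean_space \<Rightarrow> real) set" where
  "L_sym_star \<alpha> = {f. (\<forall>w. f differentiable (at w)) \<and>
     (\<exists>L0>0. \<exists>L1>0. \<forall>w w'. \<exists>M.
        is_maximum M ((\<lambda>\<theta>. rpow (norm (grad f (\<theta> *\<^sub>R w' + (1 - \<theta>) *\<^sub>R w))) \<alpha>) ` {0..1}) \<and>
        norm (grad f w' - grad f w) \<le> (L0 + L1 * M) * norm (w' - w))}"

definition unique_minimizer :: "('a \<Rightarrow> real) \<Rightarrow> bool" where
  "unique_minimizer f \<longleftrightarrow> (\<exists>!x. \<forall>y. f x \<le> f y)"

primrec beta_GD ::
  "real \<Rightarrow> real \<Rightarrow> ('a::euclidean_space \<Rightarrow> real) \<Rightarrow> 'a \<Rightarrow> nat \<Rightarrow> 'a"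
where
  "beta_GD \<beta> \<gamma> f w0 0 = w0"
| "beta_GD \<beta> \<gamma> f w0 (Suc t) =
     (let w = beta_GD \<beta> \<gamma> f w0 t; g = grad f w
      in if g = 0 then w else w - \<gamma> *\<^sub>R (g /\<^sub>R rpow (norm g) \<beta>))"

definition diverges :: "(nat \<Rightarrow> 'a::real_normed_vector) \<Rightarrow> bool" where
  "diverges w \<longleftrightarrow> filterlim (\<lambda>t. norm (w t)) at_top sequentially"

end

theory Submission
  imports Defs
begin

text \<open>
  The witness is \<open>f w = \<bar>w\<bar> powr (p + 1) / (p + 1)\<close>, whose gradient is the signed power
  \<open>g w = sgn w * \<bar>w\<bar> powr p\<close>. Two conditions on the exponent pull in opposite directions.

  Smoothness bounds \<open>p\<close> from above: \<open>g\<close> has derivative \<open>p * \<bar>w\<bar> powr (p - 1)\<close>, and this is at most a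
  multiple of \<open>1 + \<bar>g w\<bar> powr \<alpha>\<close> once \<open>p - 1 \<le> p * \<alpha>\<close>. As \<open>\<bar>g\<bar>\<close> grows with \<open>\<bar>w\<bar>\<close>, its maximum on
  a segment lies at an endpoint, and the mean value theorem gives the inequality between any two
  points (\<open>abs_power_in_L_sym_star\<close>).

  Divergence bounds \<open>p\<close> from below: a step of \<open>\<beta>\<close>-GD moves \<open>w\<close> by \<open>\<gamma> * \<bar>w\<bar> powr (p * (1 - \<beta>))\<close>
  towards the minimizer \<open>0\<close>. If \<open>p * (1 - \<beta>) > 1\<close>, this exceeds \<open>3 * \<bar>w\<bar>\<close> for all large \<open>\<bar>w\<bar>\<close>, so
  that the iterate overshoots to the other side and its absolute value at least doubles, again and
  again (\<open>abs_power_beta_GD_diverges\<close>).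

  Both conditions hold for \<open>p = 1 / (1 - \<delta>)\<close> with \<open>\<delta>\<close> strictly between \<open>\<beta>\<close> and \<open>\<alpha>\<close>, where
  \<open>p - 1 = p * \<delta>\<close>. This choice also covers \<open>\<alpha> = 1\<close>, where the bound from above is no restriction.
\<close>

text \<open>
  The chain rule through \<open>abs\<close> and \<open>sgn\<close> fails at \<open>0\<close>. There the difference quotient has absolute
  value \<open>\<bar>x\<bar> powr (r - 1)\<close>, whatever the sign of \<open>h\<close>, which settles both the even power
  \<open>\<bar>x\<bar> powr r\<close> and the odd power \<open>sgn x * \<bar>x\<bar> powr r\<close>.
\<close>
lemma DERIV_zero_if_abs_eq_powr:
  fixes h :: "real \<Rightarrow> real"
  assumes "\<And>x. \<bar>h x\<bar> = \<bar>x\<bar> powr r" "r > 1"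
  shows "(h has_real_derivative 0) (at 0)"
proof -
  have "h 0 = 0"
    using assms(1)[of 0] by simp
  moreover have "\<bar>h x / x\<bar> = \<bar>x\<bar> powr (r - 1)" if "x \<noteq> 0" for x
    using that assms(1)[of x] by (simp add: powr_diff)
  ultimately have quot: "\<bar>(h (0 + x) - h 0) / x\<bar> = \<bar>x\<bar> powr (r - 1)" if "x \<noteq> 0" for x
    using that by simp
  have "((\<lambda>x. \<bar>x\<bar> powr (r - 1)) \<longlongrightarrow> \<bar>0::real\<bar> powr (r - 1)) (at 0)"
    by (rule tendsto_powr2) (use assms(2) in \<open>auto intro!: tendsto_eq_intros\<close>)
  then have "((\<lambda>x. \<bar>x::real\<bar> powr (r - 1)) \<longlongrightarrow> 0) (at 0)"
    by simp
  then have "((\<lambda>x. \<bar>(h (0 + x) - h 0) / x\<bar>) \<longlongrightarrow> 0) (at 0)"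
  proof (rule Lim_transform_eventually)
    show "\<forall>\<^sub>F x in at 0. \<bar>x\<bar> powr (r - 1) = \<bar>(h (0 + x) - h 0) / x\<bar>"
      unfolding eventually_at_filter using quot by (intro always_eventually) metis
  qed
  then show ?thesis
    unfolding DERIV_def by (rule tendsto_rabs_zero_cancel)
qed

lemma DERIV_abs_powr:
  fixes x r :: real
  assumes "r > 1"
  shows "((\<lambda>x. \<bar>x\<bar> powr r) has_real_derivative r * (sgn x * \<bar>x\<bar> powr (r - 1))) (at x)"
proof (cases "x = 0")
  case True
  then show ?thesis
    using DERIV_zero_if_abs_eq_powr[of "\<lambda>x. \<bar>x\<bar> powr r" r] assms by simp
next
  case False
  have "(abs has_real_derivative sgn x) (at x)"
    using GDERIV_norm[OF False] by (simp add: gderiv_def has_field_derivative_def mult_commute_abs)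
  then have "((\<lambda>x. \<bar>x\<bar> powr r) has_real_derivative r * \<bar>x\<bar> powr (r - 1) * sgn x) (at x)"
    using False by (intro DERIV_chain2[OF has_real_derivative_powr]) auto
  then show ?thesis
    by (simp add: mult_ac)
qed

lemma DERIV_signed_powr:
  fixes x r :: real
  assumes "r > 1"
  shows "((\<lambda>x. sgn x * \<bar>x\<bar> powr r) has_real_derivative r * \<bar>x\<bar> powr (r - 1)) (at x)"
proof (cases "x = 0")
  case True
  then show ?thesis
    using DERIV_zero_if_abs_eq_powr[of "\<lambda>x. sgn x * \<bar>x\<bar> powr r" r] assms
    by (simp add: abs_mult abs_sgn_eq)
next
  case False
  have "((\<lambda>y. sgn x * \<bar>y\<bar> powr r) has_real_derivative sgn x * (r * (sgn x * \<bar>x\<bar> powr (r - 1)))) (at x)"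
    using DERIV_abs_powr[OF assms] by (rule DERIV_cmult)
  moreover have "sgn x * (r * (sgn x * \<bar>x\<bar> powr (r - 1))) = r * \<bar>x\<bar> powr (r - 1)"
    using False by (simp add: sgn_if)
  moreover have "\<forall>\<^sub>F y in nhds x. sgn x * \<bar>y\<bar> powr r = sgn y * \<bar>y\<bar> powr r"
  proof (cases "x > 0")
    case True
    have "\<forall>\<^sub>F y in nhds x. y \<in> {0<..}"
      by (rule eventually_nhds_in_open) (use True in auto)
    then show ?thesis
      by eventually_elim (use True in auto)
  next
    case nonpos: False
    have "\<forall>\<^sub>F y in nhds x. y \<in> {..<0}"
      by (rule eventually_nhds_in_open) (use False nonpos in auto)
    then show ?thesis
      by eventually_elim (use False nonpos in auto)
  qed
  ultimately show ?thesis
    by (subst DERIV_cong_ev[OF refl _ refl, symmetric]) auto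
qed

definition abs_power :: "real \<Rightarrow> real \<Rightarrow> real" where
  "abs_power p w = \<bar>w\<bar> powr (p + 1) / (p + 1)"

lemma DERIV_abs_power:
  assumes "p > 0"
  shows "(abs_power p has_real_derivative sgn w * \<bar>w\<bar> powr p) (at w)"
proof -
  have "((\<lambda>w. \<bar>w\<bar> powr (p + 1) / (p + 1)) has_real_derivative
      (p + 1) * (sgn w * \<bar>w\<bar> powr (p + 1 - 1)) / (p + 1)) (at w)"
    by (rule DERIV_cdivide[OF DERIV_abs_powr]) (use assms in simp)
  then show ?thesis
    unfolding abs_power_def[abs_def] using assms by simp
qed

lemma grad_abs_power:
  assumes "p > 0"
  shows "grad (abs_power p) w = sgn w * \<bar>w\<bar> powr p"
proof (rule grad_eqI)
  show "GDERIV (abs_power p) w :> sgn w * \<bar>w\<bar> powr p"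
    using DERIV_abs_power[OF assms, of w]
    unfolding gderiv_def has_field_derivative_def
    by (simp add: mult_commute_abs)
qed

lemma abs_grad_abs_power:
  assumes "p > 0"
  shows "\<bar>grad (abs_power p) w\<bar> = \<bar>w\<bar> powr p"
  by (simp add: grad_abs_power[OF assms] abs_mult abs_sgn_eq)

lemma convex_on_abs_power:
  assumes "p > 0"
  shows "convex_on UNIV (abs_power p)"
proof (rule convex_on_realI)
  show "sgn x * \<bar>x\<bar> powr p \<le> sgn y * \<bar>y\<bar> powr p" if "x \<le> y" for x y :: real
  proof (cases "x \<ge> 0 \<or> y \<le> 0")
    case True
    then show ?thesis
      using that assms by (auto simp: sgn_if intro!: powr_mono2)
  next
    case False
    then show ?thesis
      using order_trans[of "- ((- x) powr p)" 0 "y powr p"] by (simp add: sgn_if)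
  qed
qed (use DERIV_abs_power[OF assms] in auto)

lemma unique_minimizer_abs_power:
  assumes "p > 0"
  shows "unique_minimizer (abs_power p)"
  unfolding unique_minimizer_def
proof (rule ex1I)
  show "\<forall>y. abs_power p 0 \<le> abs_power p y"
    using assms by (simp add: abs_power_def)
  show "x = 0" if "\<forall>y. abs_power p x \<le> abs_power p y" for x
  proof -
    have "abs_power p x \<le> abs_power p 0"
      using that by blast
    then show ?thesis
      using assms by (simp add: abs_power_def divide_le_0_iff)
  qed
qed

text \<open>
  The derivative of the gradient grows like the power \<open>p - 1\<close>. If \<open>m\<close> is the larger of
  the absolute values of the two endpoints, the mean value theorem yields the Lipschitz constant
  \<open>p * m powr (p - 1)\<close>, the maximum on the segment is \<open>m powr (p * \<alpha>)\<close>, and \<open>p - 1 \<le> p * \<alpha>\<close>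
  lets \<open>1 + m powr (p * \<alpha>)\<close> absorb \<open>m powr (p - 1)\<close>: the first summand for \<open>m \<le> 1\<close>, the second
  for \<open>m \<ge> 1\<close>.
\<close>
lemma abs_power_in_L_sym_star:
  assumes "p > 1" "\<alpha> > 0" "p - 1 \<le> p * \<alpha>"
  shows "abs_power p \<in> L_sym_star \<alpha>"
proof -
  have "p > 0"
    using assms by simp
  have rpow_g: "rpow (norm (grad (abs_power p) x)) \<alpha> = \<bar>x\<bar> powr (p * \<alpha>)" for x
    using assms by (simp add: abs_grad_abs_power rpow_def powr_powr)
  have "\<exists>M. is_maximum M ((\<lambda>\<theta>. rpow (norm (grad (abs_power p) (\<theta> *\<^sub>R w' + (1 - \<theta>) *\<^sub>R w))) \<alpha>) ` {0..1}) \<and>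
      norm (grad (abs_power p) w' - grad (abs_power p) w) \<le> (p + p * M) * norm (w' - w)" for w w'
  proof -
    define m where "m = max \<bar>w\<bar> \<bar>w'\<bar>"
    have "m \<ge> 0"
      by (auto simp: m_def)
    have "m powr (p * \<alpha>) \<in> (\<lambda>\<theta>. \<bar>\<theta> *\<^sub>R w' + (1 - \<theta>) *\<^sub>R w\<bar> powr (p * \<alpha>)) ` {0..1}"
    proof (cases "\<bar>w\<bar> \<le> \<bar>w'\<bar>")
      case True
      then show ?thesis
        by (intro image_eqI[of _ _ 1]) (auto simp: m_def)
    next
      case False
      then show ?thesis
        by (intro image_eqI[of _ _ 0]) (auto simp: m_def)
    qed
    moreover have "\<bar>\<theta> *\<^sub>R w' + (1 - \<theta>) *\<^sub>R w\<bar> powr (p * \<alpha>) \<le> m powr (p * \<alpha>)" if "\<theta> \<in> {0..1}" for \<theta>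
    proof (rule powr_mono2)
      have "\<theta> *\<^sub>R w' + (1 - \<theta>) *\<^sub>R w \<in> cball 0 m"
        by (rule convexD[OF convex_cball]) (use that in \<open>auto simp: m_def\<close>)
      then show "\<bar>\<theta> *\<^sub>R w' + (1 - \<theta>) *\<^sub>R w\<bar> \<le> m"
        by simp
    qed (use assms in auto)
    ultimately have "is_maximum (m powr (p * \<alpha>))
        ((\<lambda>\<theta>. rpow (norm (grad (abs_power p) (\<theta> *\<^sub>R w' + (1 - \<theta>) *\<^sub>R w))) \<alpha>) ` {0..1})"
      unfolding rpow_g is_maximum_def by blast
    moreover have "norm (grad (abs_power p) w' - grad (abs_power p) w) \<le> (p + p * m powr (p * \<alpha>)) * norm (w' - w)"
    proof -
      have "norm (grad (abs_power p) w' - grad (abs_power p) w) \<le> (p * m powr (p - 1)) * norm (w' - w)"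
        unfolding grad_abs_power[OF \<open>p > 0\<close>]
      proof (rule field_differentiable_bound[of "cball 0 m"])
        show "((\<lambda>x. sgn x * \<bar>x\<bar> powr p) has_real_derivative p * \<bar>x\<bar> powr (p - 1)) (at x within cball 0 m)" for x
          by (rule has_field_derivative_at_within[OF DERIV_signed_powr[OF assms(1)]])
        show "norm (p * \<bar>x\<bar> powr (p - 1)) \<le> p * m powr (p - 1)" if "x \<in> cball 0 m" for x
          using that assms by (auto simp: abs_mult intro!: mult_left_mono powr_mono2)
      qed (auto simp: m_def)
      also have "m powr (p - 1) \<le> 1 + m powr (p * \<alpha>)"
      proof (cases "m \<le> 1")
        case True
        then have "m powr (p - 1) \<le> 1"
          using assms \<open>m \<ge> 0\<close> by (intro powr_le1) auto
        then show ?thesis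
          by (simp add: add_increasing2)
      next
        case False
        then have "m powr (p - 1) \<le> m powr (p * \<alpha>)"
          using assms by (intro powr_mono) auto
        then show ?thesis
          by simp
      qed
      finally show ?thesis
        using \<open>p > 0\<close> by (simp add: mult_left_mono mult_right_mono algebra_simps)
    qed
    ultimately show ?thesis
      by blast
  qed
  moreover have "abs_power p differentiable (at w)" for w
    using DERIV_abs_power[OF \<open>p > 0\<close>, of w] real_differentiable_def by blast
  ultimately show ?thesis
    unfolding L_sym_star_def using \<open>p > 0\<close> by blast
qed

text \<open>
  Past the threshold \<open>\<bar>w\<bar> = (3 / \<gamma>) powr (1 / (p * (1 - \<beta>) - 1))\<close> the step has length at least
  \<open>3 * \<bar>w\<bar>\<close>, so already the triangle inequality gives a factor of two. The iterate stays past the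
  threshold, and the doubling can be iterated.
\<close>
lemma abs_power_beta_GD_diverges:
  assumes "p > 0" "p * (1 - \<beta>) > 1" "\<gamma> > 0"
  defines "C \<equiv> (3 / \<gamma>) powr (1 / (p * (1 - \<beta>) - 1))"
  assumes "norm w0 > C"
  shows "diverges (beta_GD \<beta> \<gamma> (abs_power p) w0)"
proof -
  define q where "q = p * (1 - \<beta>)"
  define next_w where "next_w w = w - \<gamma> *\<^sub>R (grad (abs_power p) w /\<^sub>R rpow (norm (grad (abs_power p) w)) \<beta>)" for w
  have "q > 1"
    using assms by (simp add: q_def)
  have "C > 0"
    using assms by (simp add: C_def)
  have double: "2 * \<bar>w\<bar> \<le> \<bar>next_w w\<bar>" if "\<bar>w\<bar> > C" for w
  proof -
    have "\<bar>w\<bar> > 0"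
      using that \<open>C > 0\<close> by linarith
    have "rpow (norm (grad (abs_power p) w)) \<beta> = \<bar>w\<bar> powr (p * \<beta>)"
      using \<open>\<bar>w\<bar> > 0\<close> by (simp add: abs_grad_abs_power[OF assms(1)] rpow_def powr_powr)
    then have next_eq: "next_w w = w - \<gamma> * (sgn w * \<bar>w\<bar> powr q)"
      by (simp add: next_w_def grad_abs_power[OF assms(1)] q_def right_diff_distrib powr_diff field_simps)
    have "3 / \<gamma> = C powr (q - 1)"
      using assms \<open>q > 1\<close> by (simp add: C_def powr_powr flip: q_def)
    also have "\<dots> \<le> \<bar>w\<bar> powr (q - 1)"
      using that \<open>C > 0\<close> \<open>q > 1\<close> by (intro powr_mono2) auto
    finally have "3 \<le> \<gamma> * \<bar>w\<bar> powr (q - 1)"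
      using assms by (simp add: field_simps)
    then have "3 * \<bar>w\<bar> \<le> \<gamma> * \<bar>w\<bar> powr (q - 1) * \<bar>w\<bar>"
      by (rule mult_right_mono) simp
    also have "\<dots> = \<gamma> * \<bar>w\<bar> powr q"
      using \<open>\<bar>w\<bar> > 0\<close> by (simp add: powr_diff)
    also have "\<dots> = \<bar>\<gamma> * (sgn w * \<bar>w\<bar> powr q)\<bar>"
      using assms \<open>\<bar>w\<bar> > 0\<close> by (simp add: abs_mult abs_sgn_eq)
    finally show ?thesis
      unfolding next_eq by linarith
  qed
  have GD_Suc: "beta_GD \<beta> \<gamma> (abs_power p) w0 (Suc t) = next_w (beta_GD \<beta> \<gamma> (abs_power p) w0 t)" for t
    by (simp add: next_w_def Let_def)
  have growth: "C * 2 ^ t < \<bar>beta_GD \<beta> \<gamma> (abs_power p) w0 t\<bar>" for t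
  proof (induction t)
    case 0
    then show ?case
      using assms by simp
  next
    case (Suc t)
    have "C * 1 \<le> C * 2 ^ t"
      using \<open>C > 0\<close> by (intro mult_left_mono) auto
    with Suc have "C < \<bar>beta_GD \<beta> \<gamma> (abs_power p) w0 t\<bar>"
      by simp
    from double[OF this] Suc show ?case
      unfolding GD_Suc by simp
  qed
  have "filterlim (\<lambda>t. C * 2 ^ t) at_top sequentially"
    by (rule filterlim_tendsto_pos_mult_at_top[OF tendsto_const \<open>C > 0\<close>])
      (rule filterlim_at_infinity_imp_filterlim_at_top[OF filterlim_realpow_sequentially_gt1], auto)
  then show ?thesis
    unfolding diverges_def
    by (rule filterlim_at_top_mono) (use growth in \<open>auto intro!: always_eventually less_imp_le\<close>)
qed

theorem theorem3:
  fixes \<alpha> \<beta> :: real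
  assumes "0 < \<alpha>" "\<alpha> \<le> 1" "0 \<le> \<beta>" "\<beta> < \<alpha>"
  shows "\<exists>f :: real \<Rightarrow> real.
           convex_on UNIV f \<and> f \<in> L_sym_star \<alpha> \<and> unique_minimizer f \<and>
           (\<forall>\<gamma>>0. \<exists>C>0. \<forall>w0. norm w0 > C \<longrightarrow> diverges (beta_GD \<beta> \<gamma> f w0))"
proof -
  define \<delta> where "\<delta> = (\<alpha> + \<beta>) / 2"
  define p where "p = 1 / (1 - \<delta>)"
  have \<delta>: "0 < \<delta>" "\<delta> < 1" "\<beta> < \<delta>" "\<delta> < \<alpha>"
    using assms by (auto simp: \<delta>_def)
  then have "p > 1"
    by (simp add: p_def)
  have "p - 1 = p * \<delta>"
    using \<delta> by (simp add: p_def field_simps)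
  also have "\<dots> \<le> p * \<alpha>"
    using \<delta> \<open>p > 1\<close> by simp
  finally have smooth: "p - 1 \<le> p * \<alpha>" .
  have large: "p * (1 - \<beta>) > 1"
    using \<delta> by (simp add: p_def field_simps)
  have "\<exists>C>0. \<forall>w0. norm w0 > C \<longrightarrow> diverges (beta_GD \<beta> \<gamma> (abs_power p) w0)" if "\<gamma> > 0" for \<gamma>
    using that abs_power_beta_GD_diverges[OF _ large that] \<open>p > 1\<close>
    by (intro exI[of _ "(3 / \<gamma>) powr (1 / (p * (1 - \<beta>) - 1))"]) auto
  then show ?thesis
    using convex_on_abs_power abs_power_in_L_sym_star[OF \<open>p > 1\<close> assms(1) smooth]
      unique_minimizer_abs_power \<open>p > 1\<close>
    by (intro exI[of _ "abs_power p"]) auto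
qed

end
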